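(* Let $\varphi$ be a self-map of $T$ such that $C_\varphi$ is bounded on $\mathcal{L}_0$. If $\lambda C_\varphi$ is hypercyclic on $\mathcal{L}_0$ for some $\lambda\in\mathbb{C}$, then $\varphi$ does not have periodic points. In particular, $\varphi$ does not have fixed points.
   Context: $T$ is an infinite, locally finite tree (connected graph without cycles, identified with its vertex set) with a chosen root $o$, in which every vertex except possibly $o$ has degree greater than $1$. $d(v,w)$ is the number of edges of the unique path joining $v$ and $w$, and $|v|=d(o,v)$. $T^*=T\setminus\{o\}$. For $v\in T^*$, the parent $v^-$ is the neighbor of $v$ on the path from $o$ to $v$. The Lipschitz space $\mathcal{L}$ is the set of $f:T\to\mathbb{C}$ with $\sup_{v\in T^*}|f(v)-f(v^-)|<\infty$, a Banach space under $\|f\|_{\mathcal{L}}=\max\{|f(o)|,\sup_{v\in T^*}|f(v)-f(v^-)|\}$. The little Lipschitz space $\mathcal{L}_0$ is the closed subspace of $f\in\mathcal{L}$ with $\lim_{|v|\to\infty}|f(v)-f(v^-)|=0$. The composition operator is $C_\varphi f=f\circ\varphi$; it is bounded on $\mathcal{L}_0$ if it maps $\mathcal{L}_0$ into itself and is a bounded operator there. A bounded operator $A$ on a Banach space is hypercyclic if there is a vector $f$ (a hypercyclic vector) whose orbit $\{A^nf:n\ge 0\}$ is dense. A periodic point of $\varphi$ is a vertex $v$ with $\varphi^p(v)=v$ for some integer $p\ge1$, where $\varphi^p$ is the $p$-fold iterate. *)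

theory Defs
  imports "HOL-Analysis.Analysis"
begin

text \<open>
  A graph is given by its adjacency relation \<open>E\<close>; its vertex set is the whole type \<open>'v\<close>.
  A path is the nonempty list of its pairwise distinct vertices, so it has
  \<open>length p - 1\<close> edges.
\<close>

definition path_between :: "('v \<Rightarrow> 'v \<Rightarrow> bool) \<Rightarrow> 'v \<Rightarrow> 'v \<Rightarrow> 'v list \<Rightarrow> bool" where
  "path_between E v w p \<longleftrightarrow>
     p \<noteq> [] \<and> hd p = v \<and> last p = w \<and> distinct p \<and> successively E p"

definition simple_graph :: "('v \<Rightarrow> 'v \<Rightarrow> bool) \<Rightarrow> bool" where
  "simple_graph E \<longleftrightarrow> symp E \<and> irreflp E"

definition graph_connected :: "('v \<Rightarrow> 'v \<Rightarrow> bool) \<Rightarrow> bool" where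
  "graph_connected E \<longleftrightarrow> (\<forall>v w. \<exists>p. path_between E v w p)"

text \<open>The closing edge of a cycle joins its last listed vertex to its first one.\<close>

definition graph_cycle :: "('v \<Rightarrow> 'v \<Rightarrow> bool) \<Rightarrow> 'v list \<Rightarrow> bool" where
  "graph_cycle E c \<longleftrightarrow>
     length c \<ge> 3 \<and> distinct c \<and> successively E c \<and> E (last c) (hd c)"

definition tree :: "('v \<Rightarrow> 'v \<Rightarrow> bool) \<Rightarrow> bool" where
  "tree E \<longleftrightarrow> simple_graph E \<and> graph_connected E \<and> (\<nexists>c. graph_cycle E c)"

definition neighbors :: "('v \<Rightarrow> 'v \<Rightarrow> bool) \<Rightarrow> 'v \<Rightarrow> 'v set" where
  "neighbors E v = {w. E v w}"

definition locally_finite :: "('v \<Rightarrow> 'v \<Rightarrow> bool) \<Rightarrow> bool" where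
  "locally_finite E \<longleftrightarrow> (\<forall>v. finite (neighbors E v))"

definition vertex_degree :: "('v \<Rightarrow> 'v \<Rightarrow> bool) \<Rightarrow> 'v \<Rightarrow> nat" where
  "vertex_degree E v = card (neighbors E v)"

definition tree_path :: "('v \<Rightarrow> 'v \<Rightarrow> bool) \<Rightarrow> 'v \<Rightarrow> 'v \<Rightarrow> 'v list" where
  "tree_path E v w = (THE p. path_between E v w p)"

definition tree_dist :: "('v \<Rightarrow> 'v \<Rightarrow> bool) \<Rightarrow> 'v \<Rightarrow> 'v \<Rightarrow> nat" where
  "tree_dist E v w = length (tree_path E v w) - 1"

text \<open>Unspecified at the root \<open>v = r\<close>; the definitions below do not depend on that value.\<close>

definition parent :: "('v \<Rightarrow> 'v \<Rightarrow> bool) \<Rightarrow> 'v \<Rightarrow> 'v \<Rightarrow> 'v" where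
  "parent E r v = (THE w. w \<in> neighbors E v \<and> w \<in> set (tree_path E r v))"

definition lipschitz_space :: "('v \<Rightarrow> 'v \<Rightarrow> bool) \<Rightarrow> 'v \<Rightarrow> ('v \<Rightarrow> complex) set" where
  "lipschitz_space E r =
     {f. bdd_above ((\<lambda>v. cmod (f v - f (parent E r v))) ` (UNIV - {r}))}"

definition lipschitz_norm :: "('v \<Rightarrow> 'v \<Rightarrow> bool) \<Rightarrow> 'v \<Rightarrow> ('v \<Rightarrow> complex) \<Rightarrow> real" where
  "lipschitz_norm E r f =
     max (cmod (f r)) (SUP v\<in>UNIV - {r}. cmod (f v - f (parent E r v)))"

text \<open>The filter below expresses \<open>|v| \<rightarrow> \<infinity>\<close>, where \<open>|v| = d(r, v)\<close>.\<close>

definition little_lipschitz_space :: "('v \<Rightarrow> 'v \<Rightarrow> bool) \<Rightarrow> 'v \<Rightarrow> ('v \<Rightarrow> complex) set" where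
  "little_lipschitz_space E r =
     {f \<in> lipschitz_space E r.
        ((\<lambda>v. cmod (f v - f (parent E r v))) \<longlongrightarrow> 0) (filtercomap (tree_dist E r) at_top)}"

definition composition_operator :: "('v \<Rightarrow> 'v) \<Rightarrow> ('v \<Rightarrow> complex) \<Rightarrow> ('v \<Rightarrow> complex)" where
  "composition_operator \<phi> f = f \<circ> \<phi>"

text \<open>
  Operators on a space \<open>X\<close> of complex functions with norm \<open>N\<close>; the vector space operations
  are pointwise and the topology is the one of the metric \<open>N (f - g)\<close>.
\<close>

definition bounded_operator_on ::
  "('v \<Rightarrow> complex) set \<Rightarrow> (('v \<Rightarrow> complex) \<Rightarrow> real) \<Rightarrow>
   (('v \<Rightarrow> complex) \<Rightarrow> ('v \<Rightarrow> complex)) \<Rightarrow> bool" where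
  "bounded_operator_on X N A \<longleftrightarrow>
     (\<forall>f\<in>X. A f \<in> X) \<and>
     (\<forall>f\<in>X. \<forall>g\<in>X. \<forall>a b. A (\<lambda>v. a * f v + b * g v) = (\<lambda>v. a * A f v + b * A g v)) \<and>
     (\<exists>K. \<forall>f\<in>X. N (A f) \<le> K * N f)"

definition norm_topology ::
  "('v \<Rightarrow> complex) set \<Rightarrow> (('v \<Rightarrow> complex) \<Rightarrow> real) \<Rightarrow> ('v \<Rightarrow> complex) topology" where
  "norm_topology X N = Metric_space.mtopology X (\<lambda>f g. N (\<lambda>v. f v - g v))"

definition hypercyclic_vector ::
  "('v \<Rightarrow> complex) set \<Rightarrow> (('v \<Rightarrow> complex) \<Rightarrow> real) \<Rightarrow>
   (('v \<Rightarrow> complex) \<Rightarrow> ('v \<Rightarrow> complex)) \<Rightarrow> ('v \<Rightarrow> complex) \<Rightarrow> bool" where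
  "hypercyclic_vector X N A f \<longleftrightarrow>
     f \<in> X \<and> norm_topology X N closure_of (range (\<lambda>n. (A ^^ n) f)) = X"

definition hypercyclic_on ::
  "('v \<Rightarrow> complex) set \<Rightarrow> (('v \<Rightarrow> complex) \<Rightarrow> real) \<Rightarrow>
   (('v \<Rightarrow> complex) \<Rightarrow> ('v \<Rightarrow> complex)) \<Rightarrow> bool" where
  "hypercyclic_on X N A \<longleftrightarrow> bounded_operator_on X N A \<and> (\<exists>f. hypercyclic_vector X N A f)"

definition periodic_point :: "('v \<Rightarrow> 'v) \<Rightarrow> 'v \<Rightarrow> bool" where
  "periodic_point \<phi> v \<longleftrightarrow> (\<exists>p\<ge>1. (\<phi> ^^ p) v = v)"

end

theory Submission
  imports Defs
begin

text \<open>
  Point evaluation at \<open>v\<close> is continuous on the little Lipschitz space and maps it onto the complex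
  numbers, since the constants belong to the space. So if \<open>f\<close> is hypercyclic for \<open>c C\<^sub>\<phi>\<close>, the numbers
  \<open>c\<^sup>n f(\<phi>\<^sup>n(v))\<close> are dense in the plane. If \<open>v\<close> is periodic, \<open>f(\<phi>\<^sup>n(v))\<close> takes only finitely many
  values. Then the sequence is bounded when \<open>\<bar>c\<bar> \<le> 1\<close>, and its nonzero terms are bounded away from
  \<open>0\<close> when \<open>\<bar>c\<bar> > 1\<close>; in neither case is it dense.
\<close>

section \<open>Paths and parents in a tree\<close>

text \<open>If two paths left \<open>v\<close> through different neighbors, they would meet again,
  at the latest in \<open>w\<close>, and so close a cycle through \<open>v\<close>. Hence they share
  their second vertex, and induction applies to the tails.\<close>

lemma tree_path_between_unique:
  assumes "tree E" "path_between E v w p" "path_between E v w q"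
  shows "p = q"
  using assms(2,3)
proof (induction p arbitrary: v q)
  case Nil
  then show ?case by (simp add: path_between_def)
next
  case (Cons a p)
  have a: "a = v" using Cons.prems by (simp add: path_between_def)
  obtain q' where q: "q = v # q'"
    using Cons.prems by (cases q) (auto simp: path_between_def)
  show ?case
  proof (cases "v = w")
    case True
    have "p = []" using Cons.prems(1) True a last_in_set[of p]
      by (auto simp: path_between_def split: if_splits)
    moreover have "q' = []" using Cons.prems(2) True q last_in_set[of q']
      by (auto simp: path_between_def split: if_splits)
    ultimately show ?thesis using a q by simp
  next
    case False
    have "p \<noteq> []" "q' \<noteq> []"
      using Cons.prems q a False by (auto simp: path_between_def)
    then have p: "E v (hd p)" "successively E p" "last p = w" "distinct p" "v \<notin> set p" "p \<noteq> []"
      and q': "E v (hd q')" "successively E q'" "last q' = w" "distinct q'" "v \<notin> set q'" "q' \<noteq> []"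
      using Cons.prems q a by (auto simp: path_between_def successively_Cons)
    have "hd p = hd q'"
    proof (rule ccontr)
      assume ne: "hd p \<noteq> hd q'"
      have sym: "symp E" using assms(1) by (simp add: tree_def simple_graph_def)
      have "\<exists>z\<in>set p. z \<in> set q'" using p q' by (metis last_in_set)
      \<comment> \<open>Taking the first vertex \<open>z\<close> of \<open>p\<close> that lies on
        \<open>q'\<close> makes \<open>ps\<close> disjoint from \<open>q'\<close>, so the cycle
        built below repeats no vertex.\<close>
      then obtain ps z ps' where ps: "p = ps @ z # ps'" "z \<in> set q'" "\<forall>u\<in>set ps. u \<notin> set q'"
        by (elim split_list_first_propE) blast
      then obtain qs qs' where qs: "q' = qs @ z # qs'" by (meson split_list)
      \<comment> \<open>If \<open>ps\<close> and \<open>qs\<close> were both empty, \<open>z\<close>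
        would be the second vertex of both paths. So the cycle has a third vertex besides
        \<open>v\<close> and \<open>z\<close>.\<close>
      have nb: "ps \<noteq> [] \<or> qs \<noteq> []" using ne ps qs by auto
      have sq: "successively E (rev (qs @ [z]))"
      proof -
        have "successively E (qs @ [z])"
          using q'(2) qs by (auto simp: successively_append_iff successively_Cons)
        then show ?thesis
          unfolding successively_rev by (rule successively_mono) (auto intro: sympD[OF sym])
      qed
      have sp: "successively E (v # ps @ [z])"
        using p(1,2) ps by (auto simp: successively_append_iff successively_Cons hd_append)
      \<comment> \<open>The cycle goes from \<open>v\<close> through \<open>ps\<close> to
        \<open>z\<close> and returns backwards along \<open>qs\<close>; its last vertex is
        \<open>hd q'\<close>, which is adjacent to \<open>v\<close>.\<close>
      have "successively E ((v # ps) @ (z # rev qs))"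
        using sp sq by (subst successively_append_iff) (auto simp: successively_append_iff successively_Cons)
      moreover have "distinct ((v # ps) @ (z # rev qs))"
        using p q' ps qs by auto
      moreover have "E (last ((v # ps) @ (z # rev qs))) v"
        using q'(1) qs sym by (cases qs) (auto dest: sympD)
      moreover have "3 \<le> length ((v # ps) @ (z # rev qs))"
        using nb by (cases ps; cases qs) auto
      ultimately have "graph_cycle E ((v # ps) @ (z # rev qs))"
        by (simp add: graph_cycle_def)
      then show False using assms(1) by (auto simp: tree_def)
    qed
    then have "path_between E (hd p) w p" "path_between E (hd p) w q'"
      using p q' by (auto simp: path_between_def)
    then have "p = q'" by (rule Cons.IH)
    then show ?thesis using a q by simp
  qed
qed

lemma tree_path_eqI:
  assumes "tree E" "path_between E v w p"
  shows "tree_path E v w = p"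
  unfolding tree_path_def using assms(2)
  by (rule the_equality) (rule tree_path_between_unique[OF assms(1) _ assms(2)])

text \<open>The parent is the penultimate vertex of the path from the root, and dropping the last
  vertex of that path leaves the path to the parent. This justifies induction on the distance from
  the root.\<close>

lemma tree_dist_parent_less:
  assumes "tree E" "v \<noteq> r"
  shows "tree_dist E r (parent E r v) < tree_dist E r v"
proof -
  obtain p where p: "path_between E r v p"
    using assms(1) unfolding tree_def graph_connected_def by blast
  have tp: "tree_path E r v = p" using assms(1) p by (rule tree_path_eqI)
  have sym: "symp E" and irr: "irreflp E"
    using assms(1) by (auto simp: tree_def simple_graph_def)
  define p' where "p' = butlast p"
  have pp: "p = p' @ [v]"
    using p unfolding p'_def path_between_def by (metis append_butlast_last_id)
  have ne: "p' \<noteq> []" using p pp assms(2) by (auto simp: path_between_def)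
  have hd: "hd p' = r" "distinct p'" "v \<notin> set p'" "successively E p'" "E (last p') v"
    using p pp ne by (auto simp: path_between_def successively_append_iff)
  have "parent E r v = last p'"
    unfolding parent_def tp
  proof (rule the_equality)
    show "last p' \<in> neighbors E v \<and> last p' \<in> set p"
      using hd(5) sym ne pp by (auto simp: neighbors_def dest: sympD)
  next
    fix w assume w: "w \<in> neighbors E v \<and> w \<in> set p"
    then have Ev: "E v w" by (simp add: neighbors_def)
    then have "w \<noteq> v" using irr by (auto dest: irreflpD)
    then have "w \<in> set p'" using w pp by auto
    then obtain xs ys where xy: "p' = xs @ w # ys" by (meson split_list)
    \<comment> \<open>An earlier neighbor \<open>w\<close> on the path would close a cycle: the
      segment from \<open>w\<close> to \<open>v\<close> together with the edge back to
      \<open>w\<close>.\<close>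
    show "w = last p'"
    proof (rule ccontr)
      assume "w \<noteq> last p'"
      then have "ys \<noteq> []" using xy by auto
      moreover have "successively E (w # ys @ [v])"
        using p pp xy by (auto simp: path_between_def successively_append_iff)
      ultimately have "graph_cycle E (w # ys @ [v])"
        using hd xy Ev by (cases ys) (auto simp: graph_cycle_def)
      then show False using assms(1) by (auto simp: tree_def)
    qed
  qed
  moreover have "path_between E r (last p') p'"
    using hd ne by (simp add: path_between_def)
  then have "tree_path E r (last p') = p'" by (rule tree_path_eqI[OF assms(1)])
  ultimately show ?thesis
    using tp pp ne by (simp add: tree_dist_def)
qed

section \<open>The Lipschitz norm, its metric and point evaluations\<close>

lemma lipschitz_norm_root_le: "cmod (f r) \<le> lipschitz_norm E r f"
  by (simp add: lipschitz_norm_def)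

lemma lipschitz_norm_parent_le:
  assumes "f \<in> lipschitz_space E r" "v \<noteq> r"
  shows "cmod (f v - f (parent E r v)) \<le> lipschitz_norm E r f"
proof -
  have "cmod (f v - f (parent E r v)) \<le> (SUP v\<in>UNIV - {r}. cmod (f v - f (parent E r v)))"
    using assms by (intro cSUP_upper) (auto simp: lipschitz_space_def)
  then show ?thesis by (simp add: lipschitz_norm_def)
qed

text \<open>The hypothesis \<open>UNIV \<noteq> {r}\<close> makes the supremum range over a nonempty
  set, so that an upper bound of the increments bounds it.\<close>

lemma lipschitz_norm_le:
  assumes "UNIV \<noteq> {r}" "cmod (f r) \<le> B"
    and "\<And>v. v \<noteq> r \<Longrightarrow> cmod (f v - f (parent E r v)) \<le> B"
  shows "lipschitz_norm E r f \<le> B"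
  unfolding lipschitz_norm_def using assms by (intro max.boundedI cSUP_least) auto

lemma lipschitz_norm_nonneg: "0 \<le> lipschitz_norm E r f"
  using norm_ge_zero lipschitz_norm_root_le by (rule order_trans)

lemma lipschitz_norm_minus_commute:
  "lipschitz_norm E r (\<lambda>v. f v - g v) = lipschitz_norm E r (\<lambda>v. g v - f v)"
proof -
  have "cmod (f v - g v - (f w - g w)) = cmod (g v - f v - (g w - f w))" for v w
    by (subst norm_minus_commute) (simp add: algebra_simps)
  then show ?thesis by (simp add: lipschitz_norm_def norm_minus_commute)
qed

lemma lipschitz_space_diff:
  assumes "f \<in> lipschitz_space E r" "g \<in> lipschitz_space E r"
  shows "(\<lambda>v. f v - g v) \<in> lipschitz_space E r"
proof -
  have "cmod (f v - g v - (f (parent E r v) - g (parent E r v)))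
      \<le> lipschitz_norm E r f + lipschitz_norm E r g" if "v \<noteq> r" for v
  proof -
    have "cmod (f v - g v - (f (parent E r v) - g (parent E r v)))
       = cmod ((f v - f (parent E r v)) - (g v - g (parent E r v)))"
      by (simp add: algebra_simps)
    also have "\<dots> \<le> cmod (f v - f (parent E r v)) + cmod (g v - g (parent E r v))"
      by (rule norm_triangle_ineq4)
    also have "\<dots> \<le> lipschitz_norm E r f + lipschitz_norm E r g"
      using assms that by (intro add_mono lipschitz_norm_parent_le)
    finally show ?thesis .
  qed
  then show ?thesis unfolding lipschitz_space_def by (auto intro!: bdd_aboveI2)
qed

lemma lipschitz_norm_triangle:
  assumes "UNIV \<noteq> {r}" "f \<in> lipschitz_space E r" "g \<in> lipschitz_space E r"
  shows "lipschitz_norm E r (\<lambda>v. f v + g v) \<le> lipschitz_norm E r f + lipschitz_norm E r g"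
proof (rule lipschitz_norm_le)
  show "cmod (f r + g r) \<le> lipschitz_norm E r f + lipschitz_norm E r g"
    by (intro norm_triangle_le add_mono lipschitz_norm_root_le)
next
  fix v assume v: "v \<noteq> r"
  have "cmod (f v + g v - (f (parent E r v) + g (parent E r v)))
       = cmod ((f v - f (parent E r v)) + (g v - g (parent E r v)))"
    by (simp add: algebra_simps)
  also have "\<dots> \<le> lipschitz_norm E r f + lipschitz_norm E r g"
    using assms v by (intro norm_triangle_le add_mono lipschitz_norm_parent_le)
  finally show "cmod (f v + g v - (f (parent E r v) + g (parent E r v)))
      \<le> lipschitz_norm E r f + lipschitz_norm E r g" .
qed (fact assms(1))

text \<open>The value at \<open>v\<close> is the value at the root plus the increments along the
  path to \<open>v\<close>; each of these summands is at most the norm. This is the continuity of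
  point evaluation.\<close>

lemma norm_eval_le_lipschitz_norm:
  assumes "tree E" "f \<in> lipschitz_space E r"
  shows "cmod (f v) \<le> (1 + real (tree_dist E r v)) * lipschitz_norm E r f"
proof (induction "tree_dist E r v" arbitrary: v rule: less_induct)
  case less
  let ?N = "lipschitz_norm E r f" and ?u = "parent E r v"
  show ?case
  proof (cases "v = r")
    case True
    have "cmod (f r) \<le> 1 * ?N" by (simp add: lipschitz_norm_root_le)
    also have "\<dots> \<le> (1 + real (tree_dist E r v)) * ?N"
      by (intro mult_right_mono lipschitz_norm_nonneg) simp
    finally show ?thesis using True by simp
  next
    case False
    have lt: "tree_dist E r ?u < tree_dist E r v"
      using assms(1) False by (rule tree_dist_parent_less)
    have "cmod (f v) \<le> cmod (f v - f ?u) + cmod (f ?u)"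
      using norm_triangle_ineq[of "f v - f ?u" "f ?u"] by simp
    also have "\<dots> \<le> ?N + (1 + real (tree_dist E r ?u)) * ?N"
      using lipschitz_norm_parent_le[OF assms(2) False] less[OF lt] by simp
    also have "\<dots> = (1 + (1 + real (tree_dist E r ?u))) * ?N"
      by (simp add: algebra_simps)
    \<comment> \<open>Distances are natural numbers, so the strict inequality \<open>lt\<close>
      leaves room for the additional 1.\<close>
    also have "\<dots> \<le> (1 + real (tree_dist E r v)) * ?N"
      using lt by (intro mult_right_mono lipschitz_norm_nonneg) linarith
    finally show ?thesis .
  qed
qed

text \<open>Definiteness rests on the evaluation bound: a difference of norm 0 vanishes at every
  vertex.\<close>

lemma Metric_space_lipschitz_norm:
  assumes "tree E" "UNIV \<noteq> {r}" "X \<subseteq> lipschitz_space E r"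
  shows "Metric_space X (\<lambda>f g. lipschitz_norm E r (\<lambda>v. f v - g v))"
proof
  fix f g h
  show "0 \<le> lipschitz_norm E r (\<lambda>v. f v - g v)" by (rule lipschitz_norm_nonneg)
  show "lipschitz_norm E r (\<lambda>v. f v - g v) = lipschitz_norm E r (\<lambda>v. g v - f v)"
    by (rule lipschitz_norm_minus_commute)
  assume f: "f \<in> X" and g: "g \<in> X"
  then have diff: "(\<lambda>v. f v - g v) \<in> lipschitz_space E r"
    using assms(3) by (intro lipschitz_space_diff) auto
  show "lipschitz_norm E r (\<lambda>v. f v - g v) = 0 \<longleftrightarrow> f = g"
  proof
    assume "lipschitz_norm E r (\<lambda>v. f v - g v) = 0"
    then have "cmod (f v - g v) \<le> 0" for v
      using norm_eval_le_lipschitz_norm[OF assms(1) diff, of v] by simp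
    then show "f = g" by (auto simp: fun_eq_iff)
  next
    assume "f = g"
    then have "lipschitz_norm E r (\<lambda>v. f v - g v) \<le> 0"
      using assms(2) by (intro lipschitz_norm_le) auto
    then show "lipschitz_norm E r (\<lambda>v. f v - g v) = 0"
      using lipschitz_norm_nonneg by (rule order_antisym)
  qed
  assume h: "h \<in> X"
  then have "(\<lambda>v. g v - h v) \<in> lipschitz_space E r"
    using g assms(3) by (intro lipschitz_space_diff) auto
  from lipschitz_norm_triangle[OF assms(2) diff this]
  show "lipschitz_norm E r (\<lambda>v. f v - h v)
      \<le> lipschitz_norm E r (\<lambda>v. f v - g v) + lipschitz_norm E r (\<lambda>v. g v - h v)"
    by simp
qed

section \<open>Values of a hypercyclic orbit at one vertex\<close>

lemma const_in_little_lipschitz_space: "(\<lambda>_. a) \<in> little_lipschitz_space E r"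
  by (auto simp: little_lipschitz_space_def lipschitz_space_def)

lemma hypercyclic_vector_eval_dense:
  assumes "tree E" "UNIV \<noteq> {r}"
    and "hypercyclic_vector (little_lipschitz_space E r) (lipschitz_norm E r) A f"
    and "\<epsilon> > 0"
  obtains n where "cmod ((A ^^ n) f v - a) < \<epsilon>"
proof -
  let ?X = "little_lipschitz_space E r" and ?N = "lipschitz_norm E r"
  let ?d = "\<lambda>f g. ?N (\<lambda>v. f v - g v)"
  \<comment> \<open>\<open>D\<close> is the evaluation bound at \<open>v\<close>, so approximating
    the constant function \<open>a\<close> within \<open>\<epsilon> / D\<close> in norm approximates
    \<open>a\<close> at \<open>v\<close> within \<open>\<epsilon>\<close>.\<close>
  define D where "D = 1 + real (tree_dist E r v)"
  have sub: "?X \<subseteq> lipschitz_space E r" by (auto simp: little_lipschitz_space_def)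
  interpret Metric_space ?X ?d
    using assms(1,2) sub by (rule Metric_space_lipschitz_norm)
  have D: "D > 0" by (simp add: D_def)
  have "(\<lambda>_. a) \<in> mtopology closure_of range (\<lambda>n. (A ^^ n) f)"
    using assms(3) const_in_little_lipschitz_space[of a E r]
    by (simp add: hypercyclic_vector_def norm_topology_def)
  moreover have "\<epsilon> / D > 0" using assms(4) D by simp
  ultimately obtain n where n: "(A ^^ n) f \<in> mball (\<lambda>_. a) (\<epsilon> / D)"
    unfolding metric_closure_of by blast
  then have X: "(A ^^ n) f \<in> ?X" and less: "?N (\<lambda>v. (A ^^ n) f v - a) < \<epsilon> / D"
    using commute[of "\<lambda>_. a" "(A ^^ n) f"] by auto
  have "(\<lambda>v. (A ^^ n) f v - a) \<in> lipschitz_space E r"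
    using X sub const_in_little_lipschitz_space[of a E r] by (intro lipschitz_space_diff) auto
  from norm_eval_le_lipschitz_norm[OF assms(1) this, of v]
  have "cmod ((A ^^ n) f v - a) \<le> D * ?N (\<lambda>v. (A ^^ n) f v - a)"
    by (simp add: D_def)
  also have "\<dots> < \<epsilon>" using less D by (simp add: field_simps)
  finally show thesis by (rule that)
qed

text \<open>The induction varies \<open>v\<close> because the outermost application evaluates the
  remaining iterate at \<open>\<phi> v\<close>.\<close>

lemma funpow_weighted_composition_operator:
  "((\<lambda>f v. c * composition_operator \<phi> f v) ^^ n) f v = c ^ n * f ((\<phi> ^^ n) v)"
  by (induction n arbitrary: v) (simp_all add: composition_operator_def funpow_swap1)

lemma power_mult_finite_range_not_dense:
  fixes c :: complex and s :: "nat \<Rightarrow> complex"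
  assumes "finite (range s)"
  obtains a \<epsilon> where "\<epsilon> > 0" "\<And>n. cmod (c ^ n * s n - a) \<ge> \<epsilon>"
proof (cases "cmod c \<le> 1")
  case True
  obtain B where B: "\<And>n. cmod (s n) \<le> B"
    using finite_imp_bounded[OF assms] by (auto simp: bounded_iff)
  have B0: "B \<ge> 0" using B[of 0] norm_ge_zero order_trans by blast
  \<comment> \<open>All terms stay in the disc of radius \<open>B\<close> about 0, and
    \<open>B + 1\<close> has distance 1 from that disc.\<close>
  have "1 \<le> cmod (c ^ n * s n - of_real (B + 1))" for n
  proof -
    have "cmod (c ^ n * s n) \<le> 1 * B"
      unfolding norm_mult norm_power using True B B0 by (intro mult_mono power_le_one) auto
    moreover have "cmod (of_real (B + 1)) = B + 1" using B0 by (simp only: norm_of_real)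
    ultimately show ?thesis
      using norm_triangle_ineq2[of "of_real (B + 1)" "c ^ n * s n"]
      by (simp add: norm_minus_commute)
  qed
  then show thesis using that[of 1] by auto
next
  case False
  obtain m where m: "m > 0" "\<And>n. s n \<noteq> 0 \<Longrightarrow> m \<le> cmod (s n)"
    using finite_set_avoid[OF assms, of 0] by (auto simp: dist_norm)
  \<comment> \<open>The sequence may take the value 0, so the avoided point is not 0 but
    \<open>m / 2\<close>, halfway between 0 and the region of modulus at least \<open>m\<close> that
    contains all nonzero terms.\<close>
  have "m / 2 \<le> cmod (c ^ n * s n - of_real (m / 2))" for n
  proof (cases "s n = 0")
    case True
    have "cmod (of_real (m / 2)) = m / 2" using m(1) by (simp only: norm_of_real)
    then show ?thesis using True by (simp only: mult_zero_right diff_0 norm_minus_cancel)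
  next
    case nz: False
    have "1 * m \<le> cmod (c ^ n * s n)"
      unfolding norm_mult norm_power using False m(1) m(2)[OF nz]
      by (intro mult_mono one_le_power) auto
    moreover have "cmod (of_real (m / 2)) = m / 2" using m(1) by (simp only: norm_of_real)
    ultimately show ?thesis
      using norm_triangle_ineq2[of "c ^ n * s n" "of_real (m / 2)"] by linarith
  qed
  then show thesis using that[of "m / 2"] m(1) by auto
qed

section \<open>Absence of periodic points\<close>

theorem proposition5p1:
  fixes E :: "'v \<Rightarrow> 'v \<Rightarrow> bool" and r :: 'v and \<phi> :: "'v \<Rightarrow> 'v"
  assumes "tree E"
    and "infinite (UNIV :: 'v set)"
    and "locally_finite E"
    and "\<forall>v. v \<noteq> r \<longrightarrow> vertex_degree E v > 1"
    and "bounded_operator_on (little_lipschitz_space E r) (lipschitz_norm E r)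
           (composition_operator \<phi>)"
    and "\<exists>c::complex. hypercyclic_on (little_lipschitz_space E r) (lipschitz_norm E r)
           (\<lambda>f v. c * composition_operator \<phi> f v)"
  shows "(\<nexists>v. periodic_point \<phi> v) \<and> (\<nexists>v. \<phi> v = v)"
proof -
  obtain c f where f: "hypercyclic_vector (little_lipschitz_space E r) (lipschitz_norm E r)
      (\<lambda>f v. c * composition_operator \<phi> f v) f"
    using assms(6) by (auto simp: hypercyclic_on_def)
  have nontriv: "UNIV \<noteq> {r}" using assms(2) by (metis finite.emptyI finite_insert)
  have "\<not> periodic_point \<phi> v" for v
  proof
    assume "periodic_point \<phi> v"
    then obtain p where p: "p \<ge> 1" "(\<phi> ^^ p) v = v" by (auto simp: periodic_point_def)
    \<comment> \<open>Periodicity reduces the exponent modulo \<open>p\<close>, so at most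
      \<open>p\<close> values of \<open>f\<close> occur along the orbit of \<open>v\<close>.\<close>
    have "range (\<lambda>n. f ((\<phi> ^^ n) v)) \<subseteq> (\<lambda>n. f ((\<phi> ^^ n) v)) ` {..<p}"
    proof clarify
      fix n
      have "(\<phi> ^^ n) v = (\<phi> ^^ (n mod p)) v" using p(2) by (simp add: funpow_mod_eq)
      then show "f ((\<phi> ^^ n) v) \<in> (\<lambda>n. f ((\<phi> ^^ n) v)) ` {..<p}"
        using p(1) by (intro image_eqI[of _ _ "n mod p"]) auto
    qed
    then have "finite (range (\<lambda>n. f ((\<phi> ^^ n) v)))" by (rule finite_subset) simp
    then obtain a \<epsilon> where "\<epsilon> > 0" and far: "\<And>n. cmod (c ^ n * f ((\<phi> ^^ n) v) - a) \<ge> \<epsilon>"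
      using power_mult_finite_range_not_dense[of "\<lambda>n. f ((\<phi> ^^ n) v)" c] by blast
    obtain n where "cmod (c ^ n * f ((\<phi> ^^ n) v) - a) < \<epsilon>"
      using hypercyclic_vector_eval_dense[OF assms(1) nontriv f \<open>\<epsilon> > 0\<close>, of v a]
      unfolding funpow_weighted_composition_operator by blast
    with far[of n] show False by simp
  qed
  moreover have "periodic_point \<phi> v" if "\<phi> v = v" for v
    unfolding periodic_point_def using that by (intro exI[of _ 1]) simp
  ultimately show ?thesis by blast
qed

end
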